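(* Let $A(t)=\sum_{k\ge0}a_k\,t^k/k!$ be a formal power series over $\mathbb{C}$ with $a_0\ne0$, and let $D=d/dx$ act on the space $\mathcal{P}_n$ of polynomials of degree at most $n$. Then $$p_n(x)=A(D)x^n=\sum_{k=0}^n a_k\binom{n}{k}x^{n-k}$$ can be computed in $O(n)$ arithmetic operations. In particular, the Bernoulli polynomials $B_n(x)=\frac{D}{e^D-1}x^n$ are computed in $O(n)$ operations. The classical method (multiplication of series of length $n$) costs $\Theta(n^2)$.
   Context: $A(D):=\sum_{k\ge0}\frac{a_k}{k!}D^k$, a finite sum on $\mathcal{P}_n$ since $D^{n+1}=0$ there. $(p_n)$ is the Appell sequence with generating function $A(t)e^{xt}=\sum_{n\ge 0}p_n(x)t^n/n!$. Costs are scalar arithmetic operations, with the coefficients $a_k$ available. The classical method extracts the coefficient of $t^n/n!$ in the product $A(t)e^{xt}$ by multiplying two series of length $n+1$ by direct convolution. *)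

theory Defs
  imports
    Complex_Main
    "HOL-Computational_Algebra.Formal_Power_Series"
    "HOL-Computational_Algebra.Polynomial"
    "HOL-Library.Landau_Symbols"
begin

section \<open>Appell polynomials and operators in D\<close>

text \<open>The coefficients \<open>a\<^sub>k\<close> of \<open>A(t) = \<Sum>k. a\<^sub>k t\<^sup>k / k!\<close>.\<close>

definition egf_coeff :: "complex fps \<Rightarrow> nat \<Rightarrow> complex" where
  "egf_coeff A k = fact k * fps_nth A k"

lemma egf_coeff_series: "A = Abs_fps (\<lambda>k. egf_coeff A k / fact k)"
  by (simp add: fps_eq_iff egf_coeff_def)

text \<open>\<open>A(D) p = \<Sum>k. (a\<^sub>k / k!) D\<^sup>k p\<close>.  The terms with \<open>k > degree p\<close> vanish, so the
  sum may be cut off at the degree, or at any upper bound of it.\<close>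

definition apply_D :: "complex fps \<Rightarrow> complex poly \<Rightarrow> complex poly" where
  "apply_D A p = (\<Sum>k\<le>degree p. smult (egf_coeff A k / fact k) ((pderiv ^^ k) p))"

lemma pderiv_funpow_eq_0: "degree p < k \<Longrightarrow> (pderiv ^^ k) p = (0 :: complex poly)"
proof (induction k arbitrary: p)
  case (Suc k)
  show ?case
  proof (cases "degree p = 0")
    case True
    then have "pderiv p = 0" by (simp add: pderiv_eq_0_iff)
    moreover have "(pderiv ^^ k) 0 = (0 :: complex poly)" by (induction k) auto
    ultimately show ?thesis by (simp add: funpow_Suc_right del: funpow.simps)
  next
    case False
    with Suc.prems have "degree (pderiv p) < k" by (simp add: degree_pderiv)
    from Suc.IH[OF this] show ?thesis by (simp add: funpow_Suc_right del: funpow.simps)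
  qed
qed simp

lemma apply_D_bound:
  assumes "degree p \<le> n"
  shows "apply_D A p = (\<Sum>k\<le>n. smult (egf_coeff A k / fact k) ((pderiv ^^ k) p))"
  unfolding apply_D_def
  by (rule sum.mono_neutral_left) (use assms in \<open>auto simp: pderiv_funpow_eq_0\<close>)

text \<open>The generating function \<open>A(t) e\<^sup>x\<^sup>t = \<Sum>n. p\<^sub>n(x) t\<^sup>n / n!\<close> is read in the ring of
  power series in \<open>t\<close> over the polynomials in \<open>x\<close>.\<close>

definition exp_xt :: "complex poly fps" where
  "exp_xt = Abs_fps (\<lambda>n. monom (1 / fact n) n)"

definition appell :: "complex fps \<Rightarrow> nat \<Rightarrow> complex poly" where
  "appell A n = smult (fact n) (fps_nth (Abs_fps (\<lambda>k. [:fps_nth A k:]) * exp_xt) n)"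

lemma appell_generating_function:
  "A * fps_exp x = Abs_fps (\<lambda>n. poly (appell A n) x / fact n)"
  by (simp add: fps_eq_iff appell_def exp_xt_def fps_mult_nth poly_sum poly_monom)

definition bernoulli_series :: "complex fps" where
  "bernoulli_series = fps_X / (fps_exp 1 - 1)"

lemma bernoulli_series_mult: "bernoulli_series * (fps_exp 1 - 1) = fps_X"
proof -
  have ne: "fps_nth (fps_exp 1 - 1 :: complex fps) 1 \<noteq> 0" by simp
  then have "subdegree (fps_exp 1 - 1 :: complex fps) \<le> 1" by (rule subdegree_leI)
  moreover have "fps_exp 1 - 1 \<noteq> (0 :: complex fps)" using ne by force
  ultimately have "(fps_exp 1 - 1 :: complex fps) dvd fps_X" by (simp add: fps_dvd_iff)
  then show ?thesis unfolding bernoulli_series_def by simp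
qed

definition bernoulli_poly :: "nat \<Rightarrow> complex poly" where
  "bernoulli_poly = appell bernoulli_series"

section \<open>Scalar straight-line programs\<close>

text \<open>The inputs are the registers \<open>Coef k\<close> (holding \<open>a\<^sub>k\<close>), \<open>Point\<close> (holding a scalar
  \<open>x\<close>) and \<open>Unit\<close> (holding the only constant, 1); integers and binomial coefficients have
  to be computed.  The outputs are \<open>Out k\<close> (the coefficient of \<open>x\<^sup>k\<close>) and \<open>Val\<close> (the
  value at \<open>x\<close>).  \<open>Work w\<close> is scratch space.\<close>

datatype 'w reg = Coef nat | Point | Unit | Out nat | Val | Work 'w

datatype arith = Add | Sub | Mul | Div

text \<open>\<open>Assign r f u v\<close> is \<open>r := u f v\<close>, one arithmetic operation; the number of
  operations of a program is therefore its length.\<close>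

datatype 'w instr = Assign "'w reg" arith "'w reg" "'w reg"

type_synonym 'w state = "'w reg \<Rightarrow> complex"

fun arith_op :: "arith \<Rightarrow> complex \<Rightarrow> complex \<Rightarrow> complex option" where
  "arith_op Add u v = Some (u + v)"
| "arith_op Sub u v = Some (u - v)"
| "arith_op Mul u v = Some (u * v)"
| "arith_op Div u v = (if v = 0 then None else Some (u / v))"

fun run :: "'w instr list \<Rightarrow> 'w state \<Rightarrow> 'w state option" where
  "run [] s = Some s"
| "run (Assign r f u v # P) s =
     (case arith_op f (s u) (s v) of None \<Rightarrow> None | Some y \<Rightarrow> run P (s(r := y)))"

abbreviation num_ops :: "'w instr list \<Rightarrow> nat" where
  "num_ops \<equiv> length"

text \<open>Nothing is assumed about the initial contents of the other registers.\<close>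

definition input_state :: "complex fps \<Rightarrow> nat \<Rightarrow> complex \<Rightarrow> 'w state \<Rightarrow> bool" where
  "input_state A n x s \<longleftrightarrow> (\<forall>k\<le>n. s (Coef k) = egf_coeff A k) \<and> s Point = x \<and> s Unit = 1"

definition computes_coeffs ::
    "'w instr list \<Rightarrow> complex fps \<Rightarrow> nat \<Rightarrow> complex poly \<Rightarrow> bool" where
  "computes_coeffs P A n p \<longleftrightarrow>
     (\<forall>x s. input_state A n x s \<longrightarrow>
        (\<exists>s'. run P s = Some s' \<and> (\<Sum>k\<le>n. monom (s' (Out k)) k) = p))"

definition computes_value ::
    "'w instr list \<Rightarrow> complex fps \<Rightarrow> nat \<Rightarrow> complex poly \<Rightarrow> bool" where
  "computes_value P A n p \<longleftrightarrow>
     (\<forall>x s. input_state A n x s \<longrightarrow> (\<exists>s'. run P s = Some s' \<and> s' Val = poly p x))"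

section \<open>The classical method\<close>

text \<open>Both programs multiply the truncations of \<open>A(t)\<close> and \<open>e\<^sup>x\<^sup>t\<close> to the \<open>n + 1\<close> terms
  \<open>t\<^sup>0, \<dots>, t\<^sup>n\<close> by direct convolution, obtaining all \<open>n + 1\<close> coefficients of the
  product modulo \<open>t\<close> to the power \<open>n + 1\<close>, and then rescale the last one by \<open>n!\<close>.

  \<open>SerA k = a\<^sub>k / k!\<close>, \<open>SerE k\<close> is the coefficient of \<open>t\<^sup>k\<close> in \<open>e\<^sup>x\<^sup>t\<close>, and \<open>Prod m\<close> that of
  \<open>t\<^sup>m\<close> in the product.  When \<open>x\<close> is an indeterminate, the coefficient of \<open>t\<^sup>k\<close> in
  \<open>e\<^sup>x\<^sup>t\<close> is the monomial \<open>x\<^sup>k / k!\<close>, of which \<open>SerE k\<close> stores the scalar \<open>1 / k!\<close>;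
  the coefficient of \<open>t\<^sup>m x\<^sup>j\<close> in the product is \<open>ProdX m j\<close>, and no two summands of the
  convolution share a monomial, so they need no additions.\<close>

datatype cell = Num nat | Fac nat | Pow nat | SerA nat | SerE nat | Tmp | Prod nat | ProdX nat nat

definition factorials_prog :: "nat \<Rightarrow> cell instr list" where
  "factorials_prog n =
     [Assign (Work (Num 1)) Mul Unit Unit, Assign (Work (Fac 0)) Mul Unit Unit] @
     concat (map (\<lambda>k.
       [Assign (Work (Fac (Suc k))) Mul (Work (Fac k)) (Work (Num (Suc k))),
        Assign (Work (Num (Suc (Suc k)))) Add (Work (Num (Suc k))) Unit]) [0..<n])"

definition series_A_prog :: "nat \<Rightarrow> cell instr list" where
  "series_A_prog n =
     map (\<lambda>k. Assign (Work (SerA k)) Div (Coef k) (Work (Fac k))) [0..<Suc n]"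

definition classical_value_prog :: "nat \<Rightarrow> cell instr list" where
  "classical_value_prog n =
     factorials_prog n @ series_A_prog n @
     [Assign (Work (Pow 0)) Mul Unit Unit] @
     map (\<lambda>k. Assign (Work (Pow (Suc k))) Mul (Work (Pow k)) Point) [0..<n] @
     map (\<lambda>k. Assign (Work (SerE k)) Div (Work (Pow k)) (Work (Fac k))) [0..<Suc n] @
     concat (map (\<lambda>m.
       Assign (Work (Prod m)) Mul (Work (SerA 0)) (Work (SerE m)) #
       concat (map (\<lambda>k.
         [Assign (Work Tmp) Mul (Work (SerA k)) (Work (SerE (m - k))),
          Assign (Work (Prod m)) Add (Work (Prod m)) (Work Tmp)]) [1..<Suc m])) [0..<Suc n]) @
     [Assign Val Mul (Work (Fac n)) (Work (Prod n))]"

definition classical_coeffs_prog :: "nat \<Rightarrow> cell instr list" where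
  "classical_coeffs_prog n =
     factorials_prog n @ series_A_prog n @
     map (\<lambda>k. Assign (Work (SerE k)) Div Unit (Work (Fac k))) [0..<Suc n] @
     concat (map (\<lambda>m.
       map (\<lambda>k. Assign (Work (ProdX m (m - k))) Mul (Work (SerA k)) (Work (SerE (m - k))))
         [0..<Suc m]) [0..<Suc n]) @
     map (\<lambda>j. Assign (Out j) Mul (Work (Fac n)) (Work (ProdX n j))) [0..<Suc n]"

end

theory Submission imports Defs "HOL-Real_Asymp.Real_Asymp" begin

text \<open>
  Both descriptions of \<open>p\<^sub>n\<close> unfold to \<open>\<Sum>k\<le>n. a\<^sub>k (n choose k) x\<^bsup>n-k\<^esup>\<close>: in the generating
  function the coefficient is a convolution of \<open>a\<^sub>k / k!\<close> with \<open>x\<^bsup>n-k\<^esup> / (n-k)!\<close>, and in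
  \<open>A(D) x\<^sup>n\<close> the \<open>k\<close>-th derivative contributes the falling factorial \<open>n! / (n-k)!\<close>
  (lemmas \<open>appell_expansion\<close> and \<open>apply_D_monom\<close>).

  The explicit formula is linear in the data once the binomial coefficients are known, and a
  row of Pascal's triangle costs a constant number of operations per entry by
  \<open>(n choose (k+1)) = (n choose k) (n-k) / (k+1)\<close>.  The coefficients come out by decreasing
  power of \<open>x\<close>, which is the order in which Horner's rule consumes them.  A single loop with
  three scratch registers therefore produces the coefficients and the value
  (\<open>appell_prog_correct\<close>).  The Bernoulli polynomials are the case \<open>A(t) = t / (e\<^sup>t - 1)\<close>,
  where \<open>a\<^sub>0 = 1\<close>.

  The convolution, in contrast, forms all \<open>\<Sum>m\<le>n. m + 1\<close> products of the triangle
  \<open>i + j \<le> n\<close>, while every other phase is linear; hence the quadratic cost.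

  Correctness of all programs is shown with total-correctness triples and one loop rule, whose
  invariants state what the registers hold after \<open>k\<close> rounds.
\<close>

section \<open>Expansion of Appell polynomials\<close>

lemma poly_appell:
  "poly (appell A n) x = fact n * (\<Sum>k\<le>n. fps_nth A k * (x ^ (n - k) / fact (n - k)))"
proof -
  have "poly (appell A n) x / fact n = fps_nth (A * fps_exp x) n"
    by (simp add: appell_generating_function)
  also have "\<dots> = (\<Sum>k\<le>n. fps_nth A k * (x ^ (n - k) / fact (n - k)))"
    by (simp add: fps_mult_nth atLeast0AtMost)
  finally show ?thesis by (simp add: field_simps)
qed

lemma fact_egf_coeff:
  assumes "k \<le> n"
  shows "fact n * (fps_nth A k / fact (n - k)) = egf_coeff A k * of_nat (n choose k)"
  using assms by (simp add: egf_coeff_def binomial_fact)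

lemma appell_expansion:
  "appell A n = (\<Sum>k\<le>n. monom (egf_coeff A k * of_nat (n choose k)) (n - k))"
proof -
  have "appell A n = smult (fact n) (\<Sum>k\<le>n. monom (fps_nth A k / fact (n - k)) (n - k))"
    by (simp add: appell_def exp_xt_def fps_mult_nth atLeast0AtMost smult_monom)
  also have "\<dots> = (\<Sum>k\<le>n. monom (egf_coeff A k * of_nat (n choose k)) (n - k))"
    by (rule poly_eqI) (simp add: coeff_sum sum_distrib_left fact_egf_coeff[symmetric] if_distrib
      cong: if_cong)
  finally show ?thesis .
qed

lemma funpow_pderiv_monom:
  "k \<le> n \<Longrightarrow> (pderiv ^^ k) (monom 1 n) = monom (fact n / fact (n - k) :: complex) (n - k)"
proof (induction k)
  case (Suc k)
  then have n: "n - k = Suc (n - Suc k)" by simp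
  have "(pderiv ^^ Suc k) (monom 1 n) = pderiv (monom (fact n / fact (n - k) :: complex) (n - k))"
    using Suc by simp
  also have "\<dots> = monom (fact n / fact (n - Suc k)) (n - Suc k)"
    unfolding n by (simp add: pderiv_monom del: of_nat_Suc)
  finally show ?case .
qed simp

lemma apply_D_monom:
  "apply_D A (monom 1 n) = (\<Sum>k\<le>n. monom (egf_coeff A k * of_nat (n choose k)) (n - k))"
proof -
  have "smult (egf_coeff A k / fact k) ((pderiv ^^ k) (monom 1 n))
      = monom (egf_coeff A k * of_nat (n choose k)) (n - k)" if "k \<le> n" for k
    using that by (simp add: funpow_pderiv_monom smult_monom binomial_fact)
  then show ?thesis by (simp add: apply_D_bound[of _ n] degree_monom_eq)
qed

text \<open>Compare the coefficients of \<open>t\<close> in \<open>B(t) (e\<^sup>t - 1) = t\<close>.\<close>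

lemma bernoulli_series_nth_0: "fps_nth bernoulli_series 0 = 1"
proof -
  have "fps_nth (bernoulli_series * (fps_exp 1 - 1)) 1 = fps_nth bernoulli_series 0"
    by (simp add: fps_mult_nth)
  then show ?thesis by (simp add: bernoulli_series_mult)
qed

section \<open>Total correctness of straight-line programs\<close>

definition triple :: "('w state \<Rightarrow> bool) \<Rightarrow> 'w instr list \<Rightarrow> ('w state \<Rightarrow> bool) \<Rightarrow> bool" where
  "triple I P J \<longleftrightarrow> (\<forall>s. I s \<longrightarrow> (\<exists>s'. run P s = Some s' \<and> J s'))"

lemma triple_Nil: "triple I [] I"
  by (simp add: triple_def)

lemma triple_Assign:
  assumes "\<And>s. I s \<Longrightarrow> \<exists>y. arith_op f (s u) (s v) = Some y \<and> J (s(r := y))"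
  shows "triple I [Assign r f u v] J"
  unfolding triple_def using assms by fastforce

lemma run_append: "run (P @ Q) s = Option.bind (run P s) (run Q)"
  by (induction P s rule: run.induct) (auto split: option.split simp del: fun_upd_apply)

lemma triple_append: "triple I P J \<Longrightarrow> triple J Q K \<Longrightarrow> triple I (P @ Q) K"
  by (fastforce simp: triple_def run_append)

lemma triple_Cons: "triple I [c] J \<Longrightarrow> triple J P K \<Longrightarrow> triple I (c # P) K"
  using triple_append[of I "[c]" J P K] by simp

lemma triple_weaken:
  "triple I P J \<Longrightarrow> (\<And>s. I' s \<Longrightarrow> I s) \<Longrightarrow> (\<And>s. J s \<Longrightarrow> J' s) \<Longrightarrow> triple I' P J'"
  unfolding triple_def by blast

lemma triple_loop:
  assumes "a \<le> b" and "\<And>k. a \<le> k \<Longrightarrow> k < b \<Longrightarrow> triple (I k) (body k) (I (Suc k))"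
  shows "triple (I a) (concat (map body [a..<b])) (I b)"
  using assms
proof (induction b rule: dec_induct)
  case base
  show ?case by (simp add: triple_Nil)
next
  case (step b)
  then have "triple (I a) (concat (map body [a..<b]) @ body b) (I (Suc b))"
    by (intro triple_append) auto
  with step.hyps show ?case by simp
qed

lemma triple_map:
  assumes "a \<le> b" and "\<And>k. a \<le> k \<Longrightarrow> k < b \<Longrightarrow> triple (I k) [c k] (I (Suc k))"
  shows "triple (I a) (map c [a..<b]) (I b)"
  using triple_loop[of a b I "\<lambda>k. [c k]"] assms by simp

lemma triple_computes_value:
  assumes "\<And>x. triple (input_state A n x) P (\<lambda>s. s Val = poly p x)"
  shows "computes_value P A n p"
  using assms unfolding computes_value_def triple_def by blast

lemma triple_computes_coeffs:
  assumes "\<And>x. triple (input_state A n x) P (\<lambda>s. (\<Sum>k\<le>n. monom (s (Out k)) k) = p)"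
  shows "computes_coeffs P A n p"
  using assms unfolding computes_coeffs_def triple_def by blast

section \<open>Linear-time evaluation of Appell polynomials\<close>

text \<open>\<open>Work 0\<close> holds \<open>n - k\<close>, \<open>Work 1\<close> holds \<open>k\<close> and \<open>Work 2\<close> holds \<open>n choose k\<close>.  The number
  \<open>n\<close> itself has to be produced by repeated addition, since 1 is the only constant.\<close>

definition appell_step :: "nat \<Rightarrow> nat \<Rightarrow> nat instr list" where
  "appell_step n k =
     [Assign (Work 2) Mul (Work 2) (Work 0),
      Assign (Work 0) Sub (Work 0) Unit,
      Assign (Work 1) Add (Work 1) Unit,
      Assign (Work 2) Div (Work 2) (Work 1),
      Assign (Out (n - Suc k)) Mul (Coef (Suc k)) (Work 2),
      Assign Val Mul Val Point,
      Assign Val Add Val (Out (n - Suc k))]"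

definition appell_prog :: "nat \<Rightarrow> nat instr list" where
  "appell_prog n =
     [Assign (Work 0) Sub Unit Unit] @
     map (\<lambda>k. Assign (Work 0) Add (Work 0) Unit) [0..<n] @
     [Assign (Work 1) Sub Unit Unit,
      Assign (Work 2) Mul Unit Unit,
      Assign (Out n) Mul (Coef 0) Unit,
      Assign Val Mul (Coef 0) Unit] @
     concat (map (appell_step n) [0..<n])"

text \<open>After \<open>k\<close> rounds \<open>Val\<close> is the Horner prefix made of the \<open>k + 1\<close> highest powers, so the
  exponent in the last clause is \<open>k - i\<close>; it becomes \<open>n - i\<close> when the loop ends.\<close>

definition appell_inv :: "complex fps \<Rightarrow> nat \<Rightarrow> complex \<Rightarrow> nat \<Rightarrow> nat state \<Rightarrow> bool" where
  "appell_inv A n x k s \<longleftrightarrow>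
     input_state A n x s \<and> s (Work 0) = of_nat (n - k) \<and> s (Work 1) = of_nat k \<and>
     s (Work 2) = of_nat (n choose k) \<and>
     (\<forall>i\<le>k. s (Out (n - i)) = egf_coeff A i * of_nat (n choose i)) \<and>
     s Val = (\<Sum>i\<le>k. egf_coeff A i * of_nat (n choose i) * x ^ (k - i))"

text \<open>The recurrence along a row of Pascal's triangle.  Its divisor is the counter \<open>k + 1\<close>, which
  is never zero in \<open>\<complex>\<close>, so the program cannot get stuck.\<close>

lemma binomial_Suc_quotient:
  "of_nat (n choose k) * of_nat (n - k) / of_nat (Suc k) = (of_nat (n choose Suc k) :: complex)"
proof -
  have "(n choose k) * (n - k) = (n choose Suc k) * Suc k"
    using binomial_absorb_comp[of n k] binomial_absorption[of k n]
    by (metis mult.commute)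
  then have "of_nat (n choose k) * of_nat (n - k)
      = (of_nat (n choose Suc k) * of_nat (Suc k) :: complex)"
    by (metis of_nat_mult)
  then show ?thesis by (simp del: of_nat_Suc)
qed

lemma appell_step_correct:
  assumes "k < n"
  shows "triple (appell_inv A n x k) (appell_step n k) (appell_inv A n x (Suc k))"
  unfolding triple_def
proof (intro allI impI)
  fix s :: "nat state"
  assume inv: "appell_inv A n x k s"
  let ?c = "\<lambda>i. egf_coeff A i * of_nat (n choose i)"
  have nz: "1 + of_nat k \<noteq> (0 :: complex)"
    using of_nat_neq_0[of k, where 'a = complex] by simp
  have bin: "of_nat (n choose k) * (of_nat (n - k) / (1 + of_nat k))
      = (of_nat (n choose Suc k) :: complex)"
    using binomial_Suc_quotient[of n k] by simp
  have dec: "of_nat (n - k) - 1 = (of_nat (n - Suc k) :: complex)"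
    using assms by (simp add: of_nat_diff)
  have "(\<Sum>i\<le>k. ?c i * x ^ (k - i)) * x = (\<Sum>i\<le>k. ?c i * x ^ (Suc k - i))"
    by (auto simp: sum_distrib_right Suc_diff_le intro!: sum.cong)
  then have horner: "(\<Sum>i\<le>k. ?c i * x ^ (k - i)) * x + ?c (Suc k) = (\<Sum>i\<le>Suc k. ?c i * x ^ (Suc k - i))"
    by simp
  \<comment> \<open>the net effect of the seven assignments\<close>
  define s' where "s' = s(Work 0 := of_nat (n - Suc k), Work 1 := of_nat (Suc k),
      Work 2 := of_nat (n choose Suc k), Out (n - Suc k) := ?c (Suc k),
      Val := (\<Sum>i\<le>Suc k. ?c i * x ^ (Suc k - i)))"
  have "run (appell_step n k) s = Some s'"
    using inv assms nz
    unfolding s'_def horner[symmetric] appell_step_def appell_inv_def input_state_def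
    by (auto simp: bin dec add.commute[of "of_nat k"] fun_eq_iff times_divide_eq_right[symmetric]
      simp del: of_nat_diff times_divide_eq_right)
  moreover have "appell_inv A n x (Suc k) s'"
    using inv assms unfolding s'_def appell_inv_def input_state_def
    by (auto simp del: sum.atMost_Suc simp: le_Suc_eq)
  ultimately show "\<exists>s'. run (appell_step n k) s = Some s' \<and> appell_inv A n x (Suc k) s'"
    by blast
qed

lemma appell_prog_inv: "triple (input_state A n x) (appell_prog n) (appell_inv A n x n)"
proof -
  define J where "J k s \<longleftrightarrow> input_state A n x s \<and> s (Work 0) = of_nat k" for k and s :: "nat state"
  show ?thesis unfolding appell_prog_def
  proof (intro triple_append)
    show "triple (input_state A n x) [Assign (Work 0) Sub Unit Unit] (J 0)"
      by (rule triple_Assign) (simp add: J_def input_state_def)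
    show "triple (J 0) (map (\<lambda>k. Assign (Work 0) Add (Work 0) Unit) [0..<n]) (J n)"
      by (rule triple_map; (rule triple_Assign)?) (simp_all add: J_def input_state_def)
    show "triple (J n) [Assign (Work 1) Sub Unit Unit, Assign (Work 2) Mul Unit Unit,
        Assign (Out n) Mul (Coef 0) Unit, Assign Val Mul (Coef 0) Unit] (appell_inv A n x 0)"
      by (auto simp: triple_def J_def appell_inv_def input_state_def)
    show "triple (appell_inv A n x 0) (concat (map (appell_step n) [0..<n])) (appell_inv A n x n)"
      by (rule triple_loop) (simp_all add: appell_step_correct)
  qed
qed

lemma sum_monom_rev: "(\<Sum>k\<le>n. monom (f k) k) = (\<Sum>k\<le>n. monom (f (n - k)) (n - k))"
  for f :: "nat \<Rightarrow> complex"
  using sum.atLeastAtMost_rev[of "\<lambda>k. monom (f k) k" 0 n] by (simp add: atLeast0AtMost)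

lemma appell_prog_correct:
  "computes_coeffs (appell_prog n) A n (appell A n)"
  "computes_value (appell_prog n) A n (appell A n)"
proof -
  show "computes_coeffs (appell_prog n) A n (appell A n)"
  proof (rule triple_computes_coeffs, rule triple_weaken[OF appell_prog_inv])
    fix x s assume "appell_inv A n x n s"
    then have "s (Out (n - i)) = egf_coeff A i * of_nat (n choose i)" if "i \<le> n" for i
      using that by (simp add: appell_inv_def)
    then show "(\<Sum>k\<le>n. monom (s (Out k)) k) = appell A n"
      by (simp add: sum_monom_rev appell_expansion)
  qed
  show "computes_value (appell_prog n) A n (appell A n)"
    by (rule triple_computes_value, rule triple_weaken[OF appell_prog_inv])
       (auto simp: appell_inv_def appell_expansion poly_sum poly_monom)
qed

lemma appell_prog_length: "num_ops (appell_prog n) = 8 * n + 5"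
  by (simp add: appell_prog_def appell_step_def length_concat o_def sum_list_triv)

lemma appell_prog_linear: "(\<lambda>n. real (num_ops (appell_prog n))) \<in> O(\<lambda>n. real n)"
  unfolding appell_prog_length by real_asymp

section \<open>The classical convolution\<close>

definition facs_done :: "complex fps \<Rightarrow> nat \<Rightarrow> complex \<Rightarrow> cell state \<Rightarrow> bool" where
  "facs_done A n x s \<longleftrightarrow> input_state A n x s \<and> (\<forall>i\<le>n. s (Work (Fac i)) = fact i)"

definition series_A_done :: "complex fps \<Rightarrow> nat \<Rightarrow> complex \<Rightarrow> cell state \<Rightarrow> bool" where
  "series_A_done A n x s \<longleftrightarrow> facs_done A n x s \<and> (\<forall>i\<le>n. s (Work (SerA i)) = fps_nth A i)"

text \<open>The factor \<open>e\<^sup>x\<^sup>t\<close> is left as a parameter \<open>e\<close>: the coefficient of \<open>t\<^sup>i\<close> is stored as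
  \<open>x\<^sup>i / i!\<close> when \<open>x\<close> is a scalar and as \<open>1 / i!\<close> when \<open>x\<close> is an indeterminate.\<close>

definition factors_done ::
    "complex fps \<Rightarrow> nat \<Rightarrow> complex \<Rightarrow> (nat \<Rightarrow> complex) \<Rightarrow> cell state \<Rightarrow> bool" where
  "factors_done A n x e s \<longleftrightarrow> series_A_done A n x s \<and> (\<forall>i\<le>n. s (Work (SerE i)) = e i)"

lemmas classical_defs = factors_done_def series_A_done_def facs_done_def input_state_def

lemma factorials_prog_correct: "triple (input_state A n x) (factorials_prog n) (facs_done A n x)"
proof -
  define I where "I k s \<longleftrightarrow> input_state A n x s \<and> (\<forall>i\<le>k. s (Work (Fac i)) = fact i) \<and>
    s (Work (Num (Suc k))) = of_nat (Suc k)" for k and s :: "cell state"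
  have init: "triple (input_state A n x)
      [Assign (Work (Num 1)) Mul Unit Unit, Assign (Work (Fac 0)) Mul Unit Unit] (I 0)"
    by (auto simp: triple_def I_def input_state_def)
  have "triple (I 0) (concat (map (\<lambda>k.
       [Assign (Work (Fac (Suc k))) Mul (Work (Fac k)) (Work (Num (Suc k))),
        Assign (Work (Num (Suc (Suc k)))) Add (Work (Num (Suc k))) Unit]) [0..<n])) (I n)"
    by (rule triple_loop) (auto simp: triple_def I_def input_state_def le_Suc_eq algebra_simps)
  with init have "triple (input_state A n x) (factorials_prog n) (I n)"
    unfolding factorials_prog_def by (rule triple_append)
  then show ?thesis by (rule triple_weaken) (auto simp: I_def facs_done_def)
qed

lemma series_A_prog_correct: "triple (facs_done A n x) (series_A_prog n) (series_A_done A n x)"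
proof -
  define I where "I k s \<longleftrightarrow> facs_done A n x s \<and> (\<forall>i<k. s (Work (SerA i)) = fps_nth A i)"
    for k and s :: "cell state"
  have "triple (I 0) (series_A_prog n) (I (Suc n))"
    unfolding series_A_prog_def
    by (rule triple_map; (rule triple_Assign)?)
       (auto simp: I_def classical_defs less_Suc_eq egf_coeff_def)
  then show ?thesis by (rule triple_weaken) (auto simp: I_def series_A_done_def)
qed

text \<open>The numerators \<open>w i\<close> are the powers of \<open>x\<close> in one program and the constant 1 in the other;
  \<open>J\<close> is what is known before the phase, and must survive writing the table \<open>SerE\<close>.\<close>

lemma series_E_prog_correct:
  fixes w :: "nat \<Rightarrow> cell reg"
  assumes inv: "\<And>s i. J s \<Longrightarrow> series_A_done A n x s \<and> (i \<le> n \<longrightarrow> s (w i) = y i)"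
    and frame: "\<And>s i z. J s \<Longrightarrow> J (s(Work (SerE i) := z))"
  shows "triple J (map (\<lambda>k. Assign (Work (SerE k)) Div (w k) (Work (Fac k))) [0..<Suc n])
    (factors_done A n x (\<lambda>i. y i / fact i))"
proof -
  define I where "I k s \<longleftrightarrow> J s \<and> (\<forall>i<k. s (Work (SerE i)) = y i / fact i)"
    for k and s :: "cell state"
  have fac: "s (Work (Fac i)) = fact i" if "J s" "i \<le> n" for s i
    using inv[OF that(1)] that(2) by (simp add: classical_defs)
  have "triple (I 0) (map (\<lambda>k. Assign (Work (SerE k)) Div (w k) (Work (Fac k))) [0..<Suc n])
      (I (Suc n))"
    by (rule triple_map; (rule triple_Assign)?)
       (auto simp: I_def less_Suc_eq fac frame inv fun_upd_same fun_upd_other simp del: fun_upd_apply)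
  then show ?thesis by (rule triple_weaken) (use inv in \<open>auto simp: I_def factors_done_def\<close>)
qed

subsection \<open>The value at a scalar\<close>

lemma powers_prog_correct:
  "triple (series_A_done A n x)
     ([Assign (Work (Pow 0)) Mul Unit Unit] @
      map (\<lambda>k. Assign (Work (Pow (Suc k))) Mul (Work (Pow k)) Point) [0..<n])
     (\<lambda>s. series_A_done A n x s \<and> (\<forall>i\<le>n. s (Work (Pow i)) = x ^ i))"
proof (rule triple_append)
  let ?I = "\<lambda>k s. series_A_done A n x s \<and> (\<forall>i\<le>k. s (Work (Pow i)) = x ^ i)"
  show "triple (series_A_done A n x) [Assign (Work (Pow 0)) Mul Unit Unit] (?I 0)"
    by (rule triple_Assign) (auto simp: classical_defs)
  show "triple (?I 0) (map (\<lambda>k. Assign (Work (Pow (Suc k))) Mul (Work (Pow k)) Point) [0..<n]) (?I n)"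
    by (rule triple_map; (rule triple_Assign)?) (auto simp: classical_defs le_Suc_eq)
qed

lemma convolution_row_correct:
  assumes "m \<le> n"
  shows "triple
    (\<lambda>s. factors_done A n x e s)
    (Assign (Work (Prod m)) Mul (Work (SerA 0)) (Work (SerE m)) #
     concat (map (\<lambda>k.
       [Assign (Work Tmp) Mul (Work (SerA k)) (Work (SerE (m - k))),
        Assign (Work (Prod m)) Add (Work (Prod m)) (Work Tmp)]) [1..<Suc m]))
    (\<lambda>s. factors_done A n x e s \<and> s (Work (Prod m)) = (\<Sum>i\<le>m. fps_nth A i * e (m - i)))"
proof (rule triple_Cons)
  let ?I = "\<lambda>k s. factors_done A n x e s \<and>
    s (Work (Prod m)) = (\<Sum>i<k. fps_nth A i * e (m - i))"
  show "triple (factors_done A n x e)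
      [Assign (Work (Prod m)) Mul (Work (SerA 0)) (Work (SerE m))] (?I 1)"
    using assms by (intro triple_Assign) (auto simp: classical_defs)
  have "triple (?I 1) (concat (map (\<lambda>k.
       [Assign (Work Tmp) Mul (Work (SerA k)) (Work (SerE (m - k))),
        Assign (Work (Prod m)) Add (Work (Prod m)) (Work Tmp)]) [1..<Suc m])) (?I (Suc m))"
    using assms by (intro triple_loop) (auto simp: triple_def classical_defs)
  then show "triple (?I 1) (concat (map (\<lambda>k.
       [Assign (Work Tmp) Mul (Work (SerA k)) (Work (SerE (m - k))),
        Assign (Work (Prod m)) Add (Work (Prod m)) (Work Tmp)]) [1..<Suc m]))
      (\<lambda>s. factors_done A n x e s \<and> s (Work (Prod m)) = (\<Sum>i\<le>m. fps_nth A i * e (m - i)))"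
    by (simp only: lessThan_Suc_atMost)
qed

text \<open>Only the last coefficient of the product is read afterwards, so the invariant over the
  rows records just the most recent one.\<close>

lemma convolution_prog_correct:
  "triple (factors_done A n x e)
    (concat (map (\<lambda>m.
       Assign (Work (Prod m)) Mul (Work (SerA 0)) (Work (SerE m)) #
       concat (map (\<lambda>k.
         [Assign (Work Tmp) Mul (Work (SerA k)) (Work (SerE (m - k))),
          Assign (Work (Prod m)) Add (Work (Prod m)) (Work Tmp)]) [1..<Suc m])) [0..<Suc n]))
    (\<lambda>s. factors_done A n x e s \<and> s (Work (Prod n)) = (\<Sum>i\<le>n. fps_nth A i * e (n - i)))"
proof -
  define I where "I m s \<longleftrightarrow> factors_done A n x e s \<and>
    (\<forall>l. m = Suc l \<longrightarrow> s (Work (Prod l)) = (\<Sum>i\<le>l. fps_nth A i * e (l - i)))"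
    for m and s :: "cell state"
  have "triple (I m)
      (Assign (Work (Prod m)) Mul (Work (SerA 0)) (Work (SerE m)) #
       concat (map (\<lambda>k.
         [Assign (Work Tmp) Mul (Work (SerA k)) (Work (SerE (m - k))),
          Assign (Work (Prod m)) Add (Work (Prod m)) (Work Tmp)]) [1..<Suc m])) (I (Suc m))"
    if "m < Suc n" for m
    by (rule triple_weaken[OF convolution_row_correct[of m n A x e]]) (use that in \<open>auto simp: I_def\<close>)
  then show ?thesis
    by (intro triple_weaken[OF triple_loop[of 0 "Suc n" I]]) (auto simp: I_def)
qed

lemma classical_value_prog_correct:
  "computes_value (classical_value_prog n) A n (appell A n)"
proof (rule triple_computes_value)
  fix x
  let ?pow = "\<lambda>s. series_A_done A n x s \<and> (\<forall>i\<le>n. s (Work (Pow i)) = x ^ i)"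
  let ?e = "\<lambda>i. x ^ i / fact i"
  have series_E: "triple ?pow
      (map (\<lambda>k. Assign (Work (SerE k)) Div (Work (Pow k)) (Work (Fac k))) [0..<Suc n])
      (factors_done A n x ?e)"
    by (rule series_E_prog_correct) (auto simp: classical_defs)
  have rescale: "triple (\<lambda>s. factors_done A n x ?e s \<and>
        s (Work (Prod n)) = (\<Sum>i\<le>n. fps_nth A i * ?e (n - i)))
      [Assign Val Mul (Work (Fac n)) (Work (Prod n))] (\<lambda>s. s Val = poly (appell A n) x)"
    by (rule triple_Assign) (auto simp: classical_defs poly_appell)
  show "triple (input_state A n x) (classical_value_prog n) (\<lambda>s. s Val = poly (appell A n) x)"
    using triple_append[OF factorials_prog_correct triple_append[OF series_A_prog_correct
      triple_append[OF powers_prog_correct triple_append[OF series_E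
      triple_append[OF convolution_prog_correct rescale]]]]]
    unfolding classical_value_prog_def by simp
qed

subsection \<open>The coefficients\<close>

text \<open>With \<open>x\<close> an indeterminate, the row \<open>m\<close> of the convolution is a list of monomials of pairwise
  distinct degrees \<open>m - k\<close>, so that no later assignment overwrites an earlier one.\<close>

lemma monomial_row_correct:
  assumes "m \<le> n"
  shows "triple
    (factors_done A n x e)
    (map (\<lambda>k. Assign (Work (ProdX m (m - k))) Mul (Work (SerA k)) (Work (SerE (m - k)))) [0..<Suc m])
    (\<lambda>s. factors_done A n x e s \<and>
      (\<forall>i\<le>m. s (Work (ProdX m (m - i))) = fps_nth A i * e (m - i)))"
proof -
  define I where "I k s \<longleftrightarrow> factors_done A n x e s \<and>
    (\<forall>i<k. s (Work (ProdX m (m - i))) = fps_nth A i * e (m - i))" for k and s :: "cell state"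
  have "triple (I 0)
    (map (\<lambda>k. Assign (Work (ProdX m (m - k))) Mul (Work (SerA k)) (Work (SerE (m - k)))) [0..<Suc m])
    (I (Suc m))"
    by (rule triple_map; (rule triple_Assign)?)
       (use assms in \<open>auto simp: I_def classical_defs less_Suc_eq\<close>)
  then show ?thesis by (rule triple_weaken) (auto simp: I_def)
qed

lemma monomial_products_correct:
  "triple (factors_done A n x e)
    (concat (map (\<lambda>m.
       map (\<lambda>k. Assign (Work (ProdX m (m - k))) Mul (Work (SerA k)) (Work (SerE (m - k))))
         [0..<Suc m]) [0..<Suc n]))
    (\<lambda>s. factors_done A n x e s \<and>
      (\<forall>i\<le>n. s (Work (ProdX n (n - i))) = fps_nth A i * e (n - i)))"
proof -
  define I where "I m s \<longleftrightarrow> factors_done A n x e s \<and>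
    (\<forall>l. m = Suc l \<longrightarrow> (\<forall>i\<le>l. s (Work (ProdX l (l - i))) = fps_nth A i * e (l - i)))"
    for m and s :: "cell state"
  have "triple (I m)
      (map (\<lambda>k. Assign (Work (ProdX m (m - k))) Mul (Work (SerA k)) (Work (SerE (m - k))))
         [0..<Suc m]) (I (Suc m))"
    if "m < Suc n" for m
    by (rule triple_weaken[OF monomial_row_correct[of m n A x e]]) (use that in \<open>auto simp: I_def\<close>)
  then show ?thesis
    by (intro triple_weaken[OF triple_loop[of 0 "Suc n" I]]) (auto simp: I_def)
qed

lemma classical_coeffs_prog_correct:
  "computes_coeffs (classical_coeffs_prog n) A n (appell A n)"
proof (rule triple_computes_coeffs)
  fix x
  let ?e = "\<lambda>i. 1 / fact i :: complex"
  have series_E: "triple (series_A_done A n x)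
      (map (\<lambda>k. Assign (Work (SerE k)) Div Unit (Work (Fac k))) [0..<Suc n])
      (factors_done A n x ?e)"
    by (rule series_E_prog_correct) (auto simp: classical_defs)
  define R where "R s \<longleftrightarrow> factors_done A n x ?e s \<and>
    (\<forall>i\<le>n. s (Work (ProdX n (n - i))) = fps_nth A i * ?e (n - i))" for s :: "cell state"
  define I where "I k s \<longleftrightarrow> R s \<and>
    (\<forall>j<k. s (Out j) = fact n * (fps_nth A (n - j) * ?e j))" for k and s :: "cell state"
  have row: "s (Work (ProdX n j)) = fps_nth A (n - j) * ?e j" if "R s" "j \<le> n" for s j
    using that by (auto simp: R_def dest: spec[of _ "n - j"])
  have frame: "R (s(Out j := z))" if "R s" for s j z
    using that by (simp add: R_def classical_defs)
  have fac: "s (Work (Fac n)) = fact n" if "R s" for s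
    using that by (simp add: R_def classical_defs)
  have "triple (I 0) (map (\<lambda>j. Assign (Out j) Mul (Work (Fac n)) (Work (ProdX n j))) [0..<Suc n])
      (I (Suc n))"
    by (rule triple_map; (rule triple_Assign)?) (auto simp: I_def row frame fac less_Suc_eq fun_upd_same fun_upd_other simp del: fun_upd_apply)
  then have rescale: "triple R
      (map (\<lambda>j. Assign (Out j) Mul (Work (Fac n)) (Work (ProdX n j))) [0..<Suc n])
      (\<lambda>s. (\<Sum>k\<le>n. monom (s (Out k)) k) = appell A n)"
  proof (rule triple_weaken)
    fix s assume "I (Suc n) s"
    then have "s (Out (n - i)) = egf_coeff A i * of_nat (n choose i)" if "i \<le> n" for i
      using that fact_egf_coeff[of i n A] by (simp add: I_def)
    then show "(\<Sum>k\<le>n. monom (s (Out k)) k) = appell A n"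
      by (simp add: sum_monom_rev appell_expansion)
  qed (simp add: I_def)
  show "triple (input_state A n x) (classical_coeffs_prog n)
      (\<lambda>s. (\<Sum>k\<le>n. monom (s (Out k)) k) = appell A n)"
    using triple_append[OF factorials_prog_correct triple_append[OF series_A_prog_correct
      triple_append[OF series_E triple_append[OF
        monomial_products_correct rescale[unfolded R_def]]]]]
    unfolding classical_coeffs_prog_def by simp
qed

subsection \<open>Cost\<close>

lemma factorials_prog_length: "num_ops (factorials_prog n) = 2 * n + 2"
  by (simp add: factorials_prog_def length_concat o_def sum_list_triv)

lemma series_A_prog_length: "num_ops (series_A_prog n) = n + 1"
  by (simp add: series_A_prog_def)

lemma sum_list_upt: "sum_list (map f [0..<n]) = (\<Sum>m<n. f m)" for f :: "nat \<Rightarrow> nat"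
  by (simp add: interv_sum_list_conv_sum_set_nat atLeast0LessThan)

lemma classical_value_prog_length: "num_ops (classical_value_prog n) = (n + 1)\<^sup>2 + 5 * n + 6"
proof -
  have "(\<Sum>m<Suc n. Suc (m + m)) = (n + 1)\<^sup>2"
    by (induction n) (simp_all add: power2_eq_square)
  then show ?thesis
    by (simp add: classical_value_prog_def factorials_prog_length series_A_prog_length
      length_concat o_def sum_list_triv sum_list_upt mult_2 del: upt_Suc)
qed

text \<open>Doubling avoids the division in the triangular number \<open>(n + 1) (n + 2) / 2\<close>.\<close>

lemma classical_coeffs_prog_length:
  "2 * num_ops (classical_coeffs_prog n) = (n + 1) * (n + 2) + 10 * n + 10"
proof -
  have "2 * (\<Sum>m<Suc n. Suc m) = (n + 1) * (n + 2)"
    by (induction n) auto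
  then show ?thesis
    by (simp add: classical_coeffs_prog_def factorials_prog_length series_A_prog_length
      length_concat o_def sum_list_upt del: upt_Suc)
qed

lemma classical_value_prog_quadratic:
  "(\<lambda>n. real (num_ops (classical_value_prog n))) \<in> \<Theta>(\<lambda>n. real n ^ 2)"
  unfolding classical_value_prog_length by real_asymp

lemma classical_coeffs_prog_quadratic:
  "(\<lambda>n. real (num_ops (classical_coeffs_prog n))) \<in> \<Theta>(\<lambda>n. real n ^ 2)"
proof -
  have "real (num_ops (classical_coeffs_prog n)) = ((n + 1) * (n + 2) + 10 * n + 10) / 2" for n
    using arg_cong[OF classical_coeffs_prog_length[of n], of real] by (simp add: algebra_simps)
  then show ?thesis by (simp only:) real_asymp
qed

section \<open>Cost of computing Appell polynomials\<close>

theorem corollary3: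
  shows
    "(\<forall>(A :: complex fps) n. fps_nth A 0 \<noteq> 0 \<longrightarrow>
        appell A n = apply_D A (monom 1 n) \<and>
        apply_D A (monom 1 n) =
          (\<Sum>k\<le>n. monom (egf_coeff A k * of_nat (n choose k)) (n - k)))
   \<and> (\<exists>P :: nat \<Rightarrow> nat instr list.
        (\<lambda>n. real (num_ops (P n))) \<in> O(\<lambda>n. real n) \<and>
        (\<forall>A n. fps_nth A 0 \<noteq> 0 \<longrightarrow>
           computes_coeffs (P n) A n (appell A n) \<and>
           computes_value (P n) A n (appell A n)))
   \<and> (\<forall>n. bernoulli_poly n = apply_D (fps_X / (fps_exp 1 - 1)) (monom 1 n))
   \<and> (\<exists>P :: nat \<Rightarrow> nat instr list.
        (\<lambda>n. real (num_ops (P n))) \<in> O(\<lambda>n. real n) \<and>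
        (\<forall>n. computes_coeffs (P n) bernoulli_series n (bernoulli_poly n) \<and>
             computes_value (P n) bernoulli_series n (bernoulli_poly n)))
   \<and> (\<lambda>n. real (num_ops (classical_value_prog n))) \<in> \<Theta>(\<lambda>n. real n ^ 2)
   \<and> (\<lambda>n. real (num_ops (classical_coeffs_prog n))) \<in> \<Theta>(\<lambda>n. real n ^ 2)
   \<and> (\<forall>A n. fps_nth A 0 \<noteq> 0 \<longrightarrow>
        computes_value (classical_value_prog n) A n (appell A n) \<and>
        computes_coeffs (classical_coeffs_prog n) A n (appell A n))"
proof (intro conjI)
  show "\<exists>P :: nat \<Rightarrow> nat instr list.
      (\<lambda>n. real (num_ops (P n))) \<in> O(\<lambda>n. real n) \<and>
      (\<forall>A n. fps_nth A 0 \<noteq> 0 \<longrightarrow>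
         computes_coeffs (P n) A n (appell A n) \<and> computes_value (P n) A n (appell A n))"
    using appell_prog_linear appell_prog_correct by blast
  then show "\<exists>P :: nat \<Rightarrow> nat instr list.
      (\<lambda>n. real (num_ops (P n))) \<in> O(\<lambda>n. real n) \<and>
      (\<forall>n. computes_coeffs (P n) bernoulli_series n (bernoulli_poly n) \<and>
           computes_value (P n) bernoulli_series n (bernoulli_poly n))"
    unfolding bernoulli_poly_def using bernoulli_series_nth_0 by (metis one_neq_zero)
  show "\<forall>n. bernoulli_poly n = apply_D (fps_X / (fps_exp 1 - 1)) (monom 1 n)"
    unfolding bernoulli_poly_def bernoulli_series_def by (simp add: appell_expansion apply_D_monom)
  show "\<forall>A n. fps_nth A 0 \<noteq> 0 \<longrightarrow>
      computes_value (classical_value_prog n) A n (appell A n) \<and>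
      computes_coeffs (classical_coeffs_prog n) A n (appell A n)"
    by (simp add: classical_value_prog_correct classical_coeffs_prog_correct)
  show "(\<lambda>n. real (num_ops (classical_value_prog n))) \<in> \<Theta>(\<lambda>n. real n ^ 2)"
    by (rule classical_value_prog_quadratic)
  show "(\<lambda>n. real (num_ops (classical_coeffs_prog n))) \<in> \<Theta>(\<lambda>n. real n ^ 2)"
    by (rule classical_coeffs_prog_quadratic)
qed (simp add: appell_expansion apply_D_monom)

end
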